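(* Let $W$ be a real Banach space with norm $\|\cdot\|$ and dual norm $\|\cdot\|_\star$, and let $T\ge 1$. Let $\mathcal{A}$ be an online linear optimization algorithm on $W$ that takes hints, and suppose $\mathcal{A}$ obtains regret $R_T(\mathring{w},h_T)$ given hints $h_1\le\dots\le h_T$; that is, whenever the losses $\gamma_1,\dots,\gamma_T\in W^\star$ sent to $\mathcal{A}$ satisfy $\|\gamma_t\|_\star\le h_t$ for all $t$, the outputs $w_1,\dots,w_T$ of $\mathcal{A}$ satisfy $$\sum_{t=1}^T\langle \gamma_t,w_t-\mathring{w}\rangle\le R_T(\mathring{w},h_T)\quad\text{for all }\mathring{w}\in W.$$ Let $\mathfrak{g}>0$. Then for every sequence $g_1,\dots,g_T\in W^\star$, the points $w_1,\dots,w_T$ played by "Algorithm Without Hints" (defined in the context) with base algorithm $\mathcal{A}$ and initial value $\mathfrak{g}$ satisfy, for every $\mathring{w}\in W$, $$\sum_{t=1}^T\langle g_t,w_t-\mathring{w}\rangle\le R_T(\mathring{w},\max(\mathfrak{g},G))+G\max_{t}\|w_t\|+G\|\mathring{w}\|,$$ where $G=\max_{t}\|g_t\|_\star$.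
   Context: An online linear optimization algorithm that takes hints operates as follows: in round $t$ it first receives a hint $h_t\in\mathbb{R}$ with $h_t\ge h_{t-1}$, then outputs $w_t\in W$, then receives a loss $\gamma_t\in W^\star$ with $\|\gamma_t\|_\star\le h_t$. The expression $R_T(\mathring{w},h)$ denotes the regret bound of $\mathcal{A}$ as a function of the comparator $\mathring{w}$ and the final hint value $h$. "Algorithm Without Hints" with base algorithm $\mathcal{A}$ and initial value $\mathfrak{g}$: set $h_1=\mathfrak{g}$ (the first hint given to $\mathcal{A}$). For $t=1,\dots,T$: get $w_t$ from $\mathcal{A}$ and play $w_t$; receive $g_t\in W^\star$; if $\|g_t\|_\star\ge h_t$ set $g_t^{\mathrm{trunc}}=h_t\,g_t/\|g_t\|_\star$, otherwise set $g_t^{\mathrm{trunc}}=g_t$; set $h_{t+1}=\max(h_t,\|g_t\|_\star)$; send the loss $g_t^{\mathrm{trunc}}$ and the next hint $h_{t+1}$ to $\mathcal{A}$.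
   Formalization: The formal theorem additionally assumes that the regret bound R_T(v, h) is nondecreasing in the final hint value h on [𝔤, ∞) for every comparator v; without this the claim is false, since the last hint used may be smaller than max(𝔤, G). *)

theory Defs
  imports "HOL-Analysis.Analysis"
begin

(* Rounds are numbered from 0, so the rounds 1, ..., T of the usual presentation are 0, ..., T - 1.
   The dual space of 'a is the type of bounded linear functionals, whose norm is the dual norm. *)

(* An online linear optimization algorithm that takes hints maps the hints h_0, ..., h_t and the
   losses of the rounds before t to its output in round t. *)
type_synonym 'a hint_algorithm = "real list \<Rightarrow> ('a \<Rightarrow>\<^sub>L real) list \<Rightarrow> 'a"

definition hint_output ::
  "('a::real_normed_vector) hint_algorithm \<Rightarrow> (nat \<Rightarrow> real) \<Rightarrow> (nat \<Rightarrow> 'a \<Rightarrow>\<^sub>L real) \<Rightarrow> nat \<Rightarrow> 'a" where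
  "hint_output A h \<gamma> t = A (map h [0..<Suc t]) (map \<gamma> [0..<t])"

(* h (T - 1) is the hint of the last round; the notion is only meant for T \<ge> 1.
   Since the algorithm is deterministic, quantifying over all fixed sequences of hints and losses
   also covers sequences chosen adaptively. *)
definition obtains_regret ::
  "('a::real_normed_vector) hint_algorithm \<Rightarrow> nat \<Rightarrow> ('a \<Rightarrow> real \<Rightarrow> real) \<Rightarrow> bool" where
  "obtains_regret A T R \<longleftrightarrow>
     (\<forall>h \<gamma>. (\<forall>t. Suc t < T \<longrightarrow> h t \<le> h (Suc t)) \<longrightarrow> (\<forall>t<T. norm (\<gamma> t) \<le> h t) \<longrightarrow>
        (\<forall>u. (\<Sum>t<T. blinfun_apply (\<gamma> t) (hint_output A h \<gamma> t - u)) \<le> R u (h (T - 1))))"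

primrec no_hints_hint ::
  "real \<Rightarrow> (nat \<Rightarrow> ('a::real_normed_vector) \<Rightarrow>\<^sub>L real) \<Rightarrow> nat \<Rightarrow> real" where
  "no_hints_hint g\<^sub>0 g 0 = g\<^sub>0"
| "no_hints_hint g\<^sub>0 g (Suc t) = max (no_hints_hint g\<^sub>0 g t) (norm (g t))"

definition no_hints_trunc ::
  "real \<Rightarrow> (nat \<Rightarrow> ('a::real_normed_vector) \<Rightarrow>\<^sub>L real) \<Rightarrow> nat \<Rightarrow> 'a \<Rightarrow>\<^sub>L real" where
  "no_hints_trunc g\<^sub>0 g t =
     (if norm (g t) \<ge> no_hints_hint g\<^sub>0 g t
      then (no_hints_hint g\<^sub>0 g t / norm (g t)) *\<^sub>R g t
      else g t)"

(* The point played in round t when A is run on the hints and truncated losses above. *)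
definition no_hints_play ::
  "('a::real_normed_vector) hint_algorithm \<Rightarrow> real \<Rightarrow> (nat \<Rightarrow> 'a \<Rightarrow>\<^sub>L real) \<Rightarrow> nat \<Rightarrow> 'a" where
  "no_hints_play A g\<^sub>0 g t = hint_output A (no_hints_hint g\<^sub>0 g) (no_hints_trunc g\<^sub>0 g) t"

end

theory Submission
  imports Defs
begin

text \<open>
  Truncating the loss of round \<open>t\<close> changes it by exactly the increase of the hint from round
  \<open>t\<close> to round \<open>t + 1\<close>. These increases telescope to \<open>max g\<^sub>0 G - g\<^sub>0 \<le> G\<close>, so replacing the
  truncated losses in the regret bound of the base algorithm by the true ones costs at most
  \<open>G * (max\<^sub>t \<parallel>w\<^sub>t\<parallel> + \<parallel>u\<parallel>)\<close>.
\<close>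

lemma no_hints_hint_ge: "g\<^sub>0 \<le> no_hints_hint g\<^sub>0 g t"
  by (induction t) auto

lemma no_hints_hint_le:
  assumes "g\<^sub>0 \<le> B" and "\<And>s. s < t \<Longrightarrow> norm (g s) \<le> B"
  shows "no_hints_hint g\<^sub>0 g t \<le> B"
  using assms by (induction t) auto

text \<open>This makes the truncated losses admissible for the base algorithm. Positivity of
  \<open>g\<^sub>0\<close> makes every hint positive, so the rescaled loss has norm exactly the
  hint.\<close>

lemma norm_no_hints_trunc_le:
  assumes "g\<^sub>0 > 0"
  shows "norm (no_hints_trunc g\<^sub>0 g t) \<le> no_hints_hint g\<^sub>0 g t"
  using assms no_hints_hint_ge[of g\<^sub>0 g t] by (auto simp: no_hints_trunc_def)

text \<open>Truncation only shrinks \<open>g t\<close> along its own direction, so the norm of the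
  difference is the difference of the norms. If nothing is cut off, both sides vanish.\<close>

lemma norm_diff_no_hints_trunc:
  assumes "g\<^sub>0 > 0"
  shows "norm (g t - no_hints_trunc g\<^sub>0 g t) = no_hints_hint g\<^sub>0 g (Suc t) - no_hints_hint g\<^sub>0 g t"
proof (cases "norm (g t) \<ge> no_hints_hint g\<^sub>0 g t")
  case True
  let ?h = "no_hints_hint g\<^sub>0 g t"
  have pos: "norm (g t) > 0"
    using True assms no_hints_hint_ge[of g\<^sub>0 g t] by linarith
  have "g t - no_hints_trunc g\<^sub>0 g t = (1 - ?h / norm (g t)) *\<^sub>R g t"
    using True by (simp add: no_hints_trunc_def algebra_simps)
  moreover have "1 - ?h / norm (g t) \<ge> 0"
    using True pos by simp
  ultimately have "norm (g t - no_hints_trunc g\<^sub>0 g t) = (1 - ?h / norm (g t)) * norm (g t)"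
    by simp
  also have "\<dots> = norm (g t) - ?h"
    using pos by (simp add: field_simps)
  finally show ?thesis
    using True by simp
qed (simp add: no_hints_trunc_def)

theorem theorem2:
  fixes A :: "('a::banach) hint_algorithm"
    and T :: nat
    and R :: "'a \<Rightarrow> real \<Rightarrow> real"
    and g\<^sub>0 :: real
    and g :: "nat \<Rightarrow> 'a \<Rightarrow>\<^sub>L real"
    and u :: 'a
  assumes "T \<ge> 1"
    and "obtains_regret A T R"
    and "\<And>v. mono_on {g\<^sub>0..} (R v)"
    and "g\<^sub>0 > 0"
  shows "let w = no_hints_play A g\<^sub>0 g; G = Max ((\<lambda>t. norm (g t)) ` {..<T}) in
           (\<Sum>t<T. blinfun_apply (g t) (w t - u))
             \<le> R u (max g\<^sub>0 G) + G * Max ((\<lambda>t. norm (w t)) ` {..<T}) + G * norm u"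
proof -
  define w where "w = no_hints_play A g\<^sub>0 g"
  define G where "G = Max ((\<lambda>t. norm (g t)) ` {..<T})"
  define M where "M = Max ((\<lambda>t. norm (w t)) ` {..<T})"
  define h where "h = no_hints_hint g\<^sub>0 g"
  define \<gamma> where "\<gamma> = no_hints_trunc g\<^sub>0 g"
  have norm_g: "norm (g t) \<le> G" and norm_w: "norm (w t) \<le> M" if "t < T" for t
    using that by (auto simp: G_def M_def intro!: Max_ge)
  \<comment> \<open>Since \<open>T \<ge> 1\<close>, round 0 exists and its norms are lower bounds
    for both maxima.\<close>
  have "G \<ge> 0" "M \<ge> 0"
    using norm_g[of 0] norm_w[of 0] \<open>T \<ge> 1\<close> norm_ge_zero[of "g 0"] norm_ge_zero[of "w 0"]
    by linarith+
  have h_le: "h t \<le> max g\<^sub>0 G" if "t \<le> T" for t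
    unfolding h_def using that norm_g by (intro no_hints_hint_le) (auto simp: le_max_iff_disj)
  have "(\<Sum>t<T. blinfun_apply (\<gamma> t) (w t - u)) \<le> R u (h (T - 1))"
    using assms(2) norm_no_hints_trunc_le[OF \<open>g\<^sub>0 > 0\<close>, of g]
    by (auto simp: obtains_regret_def w_def no_hints_play_def h_def \<gamma>_def)
  \<comment> \<open>The last hint \<open>h (T - 1)\<close> precedes the loss
    \<open>g (T - 1)\<close>, so it may lie strictly below \<open>max g\<^sub>0 G\<close>;
    monotonicity of \<open>R u\<close> on \<open>{g\<^sub>0..}\<close> bridges the gap.\<close>
  also have "\<dots> \<le> R u (max g\<^sub>0 G)"
    using h_le[of "T - 1"]
    by (intro mono_onD[OF assms(3)]) (auto simp: h_def no_hints_hint_ge)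
  finally have base: "(\<Sum>t<T. blinfun_apply (\<gamma> t) (w t - u)) \<le> R u (max g\<^sub>0 G)" .
  have "(\<Sum>t<T. blinfun_apply (g t - \<gamma> t) (w t - u)) \<le> (\<Sum>t<T. (h (Suc t) - h t) * (M + norm u))"
  proof (intro sum_mono)
    fix t assume "t \<in> {..<T}"
    have "blinfun_apply (g t - \<gamma> t) (w t - u) \<le> norm (g t - \<gamma> t) * norm (w t - u)"
      using norm_blinfun[of "g t - \<gamma> t" "w t - u"] by simp
    also have "\<dots> \<le> norm (g t - \<gamma> t) * (M + norm u)"
      using norm_triangle_ineq4[of "w t" u] norm_w[of t] \<open>t \<in> {..<T}\<close>
      by (intro mult_left_mono) auto
    also have "norm (g t - \<gamma> t) = h (Suc t) - h t"
      unfolding h_def \<gamma>_def by (rule norm_diff_no_hints_trunc[OF \<open>g\<^sub>0 > 0\<close>])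
    finally show "blinfun_apply (g t - \<gamma> t) (w t - u) \<le> (h (Suc t) - h t) * (M + norm u)" .
  qed
  \<comment> \<open>The hint at \<open>Suc t\<close> must stay folded: rewritten as a maximum, the
    sum would no longer have telescoping form.\<close>
  also have "\<dots> = (h T - g\<^sub>0) * (M + norm u)"
    by (simp add: sum_distrib_right[symmetric] sum_lessThan_telescope h_def del: no_hints_hint.simps(2))
  \<comment> \<open>Here \<open>h T - g\<^sub>0 \<le> max 0 (G - g\<^sub>0) \<le> G\<close>, because
    \<open>g\<^sub>0\<close> is positive and \<open>G\<close> is nonnegative.\<close>
  also have "\<dots> \<le> G * (M + norm u)"
    using h_le[of T] \<open>G \<ge> 0\<close> \<open>M \<ge> 0\<close> \<open>g\<^sub>0 > 0\<close> by (intro mult_right_mono) auto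
  finally have "(\<Sum>t<T. blinfun_apply (g t) (w t - u))
      \<le> (\<Sum>t<T. blinfun_apply (\<gamma> t) (w t - u)) + G * (M + norm u)"
    by (simp add: blinfun.diff_left sum_subtractf)
  with base show ?thesis
    unfolding Let_def w_def[symmetric] G_def[symmetric] M_def[symmetric]
    by (simp add: algebra_simps)
qed

end
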